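(* Suppose that the family $\mathscr T(\ell,\mathscr M)$ satisfies Assumption 1 (recalled in the context) with constants $a_0\ge a_1>0$. Let $\mathbf P,\mathbf Q$ be two distinct elements of $\mathbf M$ and let $\mathbf P^\star\in\mathscr P^n$ be such that $$\gamma=\frac{a_0\boldsymbol\ell(\mathbf P^\star,\mathbf P)}{a_1\boldsymbol\ell(\mathbf P^\star,\mathbf Q)}<1.$$ Then $$\mathbb P\left[\Phi_{(\mathbf P,\mathbf Q)}(\boldsymbol X)=1\right]\le\exp\left[-\frac{2\boldsymbol\ell^2(\mathbf P^\star,\mathbf Q)}{n}\left[a_1(1-\gamma)\right]^2\right].$$ If, moreover, there is $a_2>0$ such that $\operatorname{Var}_S[t_{(P,Q)}(X)]\le a_2[\ell(S,P)+\ell(S,Q)]$ for all $S\in\mathscr P$ and $P,Q\in\mathscr M$, then $$\mathbb P\left[\Phi_{(\mathbf P,\mathbf Q)}(\boldsymbol X)=1\right]\le\exp\left[-\frac{\boldsymbol\ell(\mathbf P^\star,\mathbf Q)}{2}\,\frac{a_1(1-\gamma)^2}{[(1-\gamma)/3]+[(1+\gamma(a_1/a_0))(a_2/a_1)]}\right].$$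
   Context: Framework. $(E,\mathcal E)$ is a measurable space with a $\sigma$-finite measure $\mu$, and $n\ge1$. $\mathscr P$ is a set of probability measures on $(E,\mathcal E)$; $\mathscr M$ is an at most countable set of finite, possibly signed, measures of the form $P=p\cdot\mu$; $\mathbf M\subset\mathscr M^n$. $\ell:\mathscr P\times\mathscr M\to[0,+\infty)$ is a loss function, not identically $0$. The observation is $\boldsymbol X=(X_1,\ldots,X_n)$ with $X_1,\ldots,X_n$ independent, $X_i\sim P_i^\star\in\mathscr P$, and $\mathbf P^\star=(P_1^\star,\ldots,P_n^\star)$; $\mathbb P$ refers to this true distribution, while $\mathbb E_S,\operatorname{Var}_S$ are expectation and variance when $X\sim S$. For $\mathbf P\in\mathscr P^n$, $\mathbf Q\in\mathbf M$, $\boldsymbol\ell(\mathbf P,\mathbf Q)=\sum_{i=1}^n\ell(P_i,Q_i)$. The definition of $\gamma$ presupposes $\boldsymbol\ell(\mathbf P^\star,\mathbf Q)>0$. Assumption 1. $\mathscr T(\ell,\mathscr M)=\{t_{(P,Q)},\ (P,Q)\in\mathscr M^2\}$ is a family of real-valued measurable functions on $E$ such that: (i) $t_{(P,Q)}=-t_{(Q,P)}$ for all $P,Q\in\mathscr M$; (ii) there are positive numbers $a_0,a_1$ (necessarily $a_1\le a_0$) with $\mathbb E_S[t_{(P,Q)}(X)]\le a_0\ell(S,P)-a_1\ell(S,Q)$ for all $S\in\mathscr P$, $P,Q\in\mathscr M$; (iii) $\sup_{x\in E}t_{(P,Q)}(x)-\inf_{x\in E}t_{(P,Q)}(x)\le1$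 for all $P,Q\in\mathscr M$. Test. With $\mathbf T(\boldsymbol X,\mathbf P,\mathbf Q)=\sum_{i=1}^nt_{(P_i,Q_i)}(X_i)$, the test $\Phi_{(\mathbf P,\mathbf Q)}(\boldsymbol X)\in\{0,1\}$ equals $1$ if $\mathbf T(\boldsymbol X,\mathbf P,\mathbf Q)>0$, equals $0$ if $\mathbf T(\boldsymbol X,\mathbf P,\mathbf Q)<0$, and takes an arbitrary (measurable) value when $\mathbf T(\boldsymbol X,\mathbf P,\mathbf Q)=0$. *)

theory Defs
  imports "HOL-Probability.Probability"
begin

text \<open>
  A finite signed measure \<open>P = p \<cdot> \<mu>\<close> is encoded as the real set function
  \<open>A \<mapsto> \<integral>\<^sub>A p d\<mu>\<close>, with value 0 outside the \<open>\<sigma>\<close>-algebra, so that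
  HOL equality is equality of measures (and not of densities).
\<close>

type_synonym 'a signed_measure = "'a set \<Rightarrow> real"

definition signed_density :: "'a measure \<Rightarrow> ('a \<Rightarrow> real) \<Rightarrow> 'a signed_measure" where
  "signed_density \<mu> p A = (if A \<in> sets \<mu> then set_lebesgue_integral \<mu> A p else 0)"

definition finite_signed_ac :: "'a measure \<Rightarrow> 'a signed_measure \<Rightarrow> bool" where
  "finite_signed_ac \<mu> P \<longleftrightarrow> (\<exists>p. integrable \<mu> p \<and> P = signed_density \<mu> p)"

text \<open>
  Throughout, \<open>n\<close>-tuples are extensional functions on \<open>{1..n}\<close>, i.e. elements of
  \<open>{1..n} \<rightarrow>\<^sub>E A\<close>, so that two tuples are equal iff their \<open>n\<close> coordinates agree.
\<close>

definition total_loss ::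
  "('a measure \<Rightarrow> 'a signed_measure \<Rightarrow> real) \<Rightarrow> nat \<Rightarrow>
   (nat \<Rightarrow> 'a measure) \<Rightarrow> (nat \<Rightarrow> 'a signed_measure) \<Rightarrow> real" where
  "total_loss l n P Q = (\<Sum>i=1..n. l (P i) (Q i))"

text \<open>
  The oscillation bound is stated in the extended reals: the supremum and infimum of an
  unbounded set of reals are unspecified in HOL. In \<open>ereal\<close> the difference is \<open>\<infinity>\<close> as soon as
  the supremum is \<open>\<infinity>\<close> or the infimum is \<open>-\<infinity>\<close> (on a nonempty space), so the
  bound entails that every \<open>t (P, Q)\<close> is bounded.
\<close>

definition admissible_family ::
  "'a measure \<Rightarrow> 'a measure set \<Rightarrow> 'a signed_measure set \<Rightarrow>
   ('a measure \<Rightarrow> 'a signed_measure \<Rightarrow> real) \<Rightarrow> real \<Rightarrow> real \<Rightarrow>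
   ('a signed_measure \<times> 'a signed_measure \<Rightarrow> 'a \<Rightarrow> real) \<Rightarrow> bool" where
  "admissible_family \<mu> \<PP> \<MM> l a0 a1 t \<longleftrightarrow>
     (\<forall>P\<in>\<MM>. \<forall>Q\<in>\<MM>. t (P, Q) \<in> borel_measurable \<mu>) \<and>
     (\<forall>P\<in>\<MM>. \<forall>Q\<in>\<MM>. \<forall>x\<in>space \<mu>. t (P, Q) x = - t (Q, P) x) \<and>
     0 < a0 \<and> 0 < a1 \<and>
     (\<forall>S\<in>\<PP>. \<forall>P\<in>\<MM>. \<forall>Q\<in>\<MM>.
        prob_space.expectation S (t (P, Q)) \<le> a0 * l S P - a1 * l S Q) \<and>
     (\<forall>P\<in>\<MM>. \<forall>Q\<in>\<MM>.
        (SUP x\<in>space \<mu>. ereal (t (P, Q) x)) - (INF x\<in>space \<mu>. ereal (t (P, Q) x)) \<le> 1)"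

definition test_statistic ::
  "('a signed_measure \<times> 'a signed_measure \<Rightarrow> 'a \<Rightarrow> real) \<Rightarrow> nat \<Rightarrow>
   (nat \<Rightarrow> 'a) \<Rightarrow> (nat \<Rightarrow> 'a signed_measure) \<Rightarrow> (nat \<Rightarrow> 'a signed_measure) \<Rightarrow> real" where
  "test_statistic t n x P Q = (\<Sum>i=1..n. t (P i, Q i) (x i))"

text \<open>
  The value of the test on the tie set \<open>test_statistic t n x P Q = 0\<close> is left free, so this is
  a predicate satisfied by every admissible choice there.
\<close>

definition is_test ::
  "'a measure \<Rightarrow> ('a signed_measure \<times> 'a signed_measure \<Rightarrow> 'a \<Rightarrow> real) \<Rightarrow> nat \<Rightarrow>
   (nat \<Rightarrow> 'a signed_measure) \<Rightarrow> (nat \<Rightarrow> 'a signed_measure) \<Rightarrow> ((nat \<Rightarrow> 'a) \<Rightarrow> nat) \<Rightarrow> bool" where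
  "is_test \<mu> t n P Q \<Phi> \<longleftrightarrow>
     \<Phi> \<in> measurable (PiM {1..n} (\<lambda>_. \<mu>)) (count_space {0, 1}) \<and>
     (\<forall>x\<in>space (PiM {1..n} (\<lambda>_. \<mu>)).
        (0 < test_statistic t n x P Q \<longrightarrow> \<Phi> x = 1) \<and>
        (test_statistic t n x P Q < 0 \<longrightarrow> \<Phi> x = 0))"

end

theory Submission
  imports Defs
begin

text \<open>
  The test can equal 1 only when the statistic \<open>T = (\<Sum>i. t (P\<^sub>i, Q\<^sub>i) (X\<^sub>i))\<close> is nonnegative.
  Summing the bound on the expectations of the \<open>t (P\<^sub>i, Q\<^sub>i)\<close> over the coordinates, the mean of
  \<open>T\<close> is at most \<open>a0 \<ell>(P\<^sup>\<star>, P) - a1 \<ell>(P\<^sup>\<star>, Q) = -s\<close> with \<open>s = a1 (1 - \<gamma>) \<ell>(P\<^sup>\<star>, Q) > 0\<close>,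
  where \<open>\<ell>\<close> is the total loss. An error of the test therefore forces \<open>T\<close>, a sum of independent
  variables, to exceed its mean by at least \<open>s\<close>.

  Each summand ranges in an interval of length 1 (\<open>bounded_of_oscillation_le\<close>), so Hoeffding's
  inequality bounds the probability of this deviation by \<open>exp (- 2 s\<^sup>2 / n)\<close>, the first claim.
  Under the variance condition, the variances of the summands add up to at most
  \<open>v = a2 (\<ell>(P\<^sup>\<star>, P) + \<ell>(P\<^sup>\<star>, Q)) = a2 (1 + \<gamma> a1 / a0) \<ell>(P\<^sup>\<star>, Q)\<close>, and each summand is within 1 of
  its mean; Bernstein's inequality (\<open>Bernstein_ineq_ge\<close>) bounds the probability by
  \<open>exp (- s\<^sup>2 / (2 (v + s / 3)))\<close>. Dividing numerator and denominator by \<open>a1 \<ell>(P\<^sup>\<star>, Q)\<close> gives the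
  second claim. Bernstein's inequality itself follows from Chernoff's method and a quadratic
  bound on the exponential (\<open>exp_le_quadratic\<close>).
\<close>

section \<open>Bernstein's inequality\<close>

text \<open>
  For \<open>k \<ge> 2\<close> one has \<open>k! \<ge> 2 \<cdot> 3\<^sup>k\<^sup>-\<^sup>2\<close>, so the tail of the exponential series from the quadratic
  term on is dominated by \<open>x\<^sup>2 / 2\<close> times the geometric series of ratio \<open>\<bar>x\<bar> / 3\<close>.
\<close>

lemma exp_le_quadratic:
  fixes x :: real
  assumes "\<bar>x\<bar> < 3"
  shows "exp x \<le> 1 + x + x\<^sup>2 / (2 * (1 - \<bar>x\<bar> / 3))"
proof -
  have fact_ge: "2 * 3 ^ k \<le> (fact (k + 2) :: real)" for k
  proof (induction k)
    case (Suc k)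
    have "2 * 3 ^ Suc k \<le> 3 * (fact (k + 2) :: real)"
      using Suc by (simp del: fact_Suc add_2_eq_Suc')
    also have "\<dots> \<le> (real k + 3) * fact (k + 2)"
      by (intro mult_right_mono) auto
    also have "\<dots> = fact (Suc k + 2)"
      by (simp add: mult_ac add_ac)
    finally show ?case .
  qed (simp add: eval_nat_numeral)
  have geom: "(\<lambda>k. (x\<^sup>2 / 2) * (\<bar>x\<bar> / 3) ^ k) sums ((x\<^sup>2 / 2) * (1 / (1 - \<bar>x\<bar> / 3)))"
    using assms by (intro sums_mult geometric_sums) auto
  have term_le: "inverse (fact (k + 2)) *\<^sub>R x ^ (k + 2) \<le> (x\<^sup>2 / 2) * (\<bar>x\<bar> / 3) ^ k" for k
  proof -
    have "inverse (fact (k + 2)) *\<^sub>R x ^ (k + 2) \<le> \<bar>x\<bar> ^ (k + 2) / fact (k + 2)"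
      by (simp add: divide_inverse mult.commute power_abs[symmetric] mult_right_mono
               del: power_Suc fact_Suc add_2_eq_Suc')
    also have "\<dots> \<le> \<bar>x\<bar> ^ (k + 2) / (2 * 3 ^ k)"
      using fact_ge by (intro divide_left_mono) auto
    also have "\<dots> = (x\<^sup>2 / 2) * (\<bar>x\<bar> / 3) ^ k"
      by (simp add: power_add power_divide power2_eq_square)
    finally show ?thesis .
  qed
  have "summable (\<lambda>k. inverse (fact (k + 2)) *\<^sub>R x ^ (k + 2))"
    using summable_exp_generic[of x] by (subst summable_iff_shift)
  then have "(\<Sum>k. inverse (fact (k + 2)) *\<^sub>R x ^ (k + 2)) \<le> (x\<^sup>2 / 2) * (1 / (1 - \<bar>x\<bar> / 3))"
    using suminf_le[OF term_le _ sums_summable[OF geom]] sums_unique[OF geom] by simp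
  then show ?thesis
    by (simp add: exp_first_two_terms[of x] del: power_Suc fact_Suc add_2_eq_Suc')
qed

text \<open>
  The linear term of the quadratic bound integrates to 0 and the quadratic one to the variance;
  \<open>1 + u \<le> exp u\<close> then gives a bound that is multiplicative over independent summands.
\<close>

lemma (in prob_space) Bernstein_lemma_nn_integral:
  fixes f :: "'a \<Rightarrow> real"
  assumes [measurable]: "random_variable borel f"
    and bnd: "AE x in M. \<bar>f x\<bar> \<le> b" and E0: "expectation f = 0"
    and c: "0 \<le> c" "c * b < 3"
  shows "(\<integral>\<^sup>+x. exp (c * f x) \<partial>M)
           \<le> ennreal (exp (c\<^sup>2 * expectation (\<lambda>x. (f x)\<^sup>2) / (2 * (1 - c * b / 3))))"
proof -
  define K where "K = c\<^sup>2 / (2 * (1 - c * b / 3))"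
  have int: "integrable M f"
    by (rule integrable_const_bound[where B = b]) (use bnd in auto)
  have int2: "integrable M (\<lambda>x. (f x)\<^sup>2)"
  proof (rule integrable_const_bound[where B = "b\<^sup>2"])
    show "AE x in M. norm ((f x)\<^sup>2) \<le> b\<^sup>2"
      using bnd by eventually_elim (metis abs_ge_zero norm_power power_mono real_norm_def)
  qed auto
  have quad: "AE x in M. exp (c * f x) \<le> 1 + c * f x + K * (f x)\<^sup>2"
    using bnd
  proof eventually_elim
    fix x assume x: "\<bar>f x\<bar> \<le> b"
    have le: "\<bar>c * f x\<bar> \<le> c * b"
      using x c by (simp add: abs_mult mult_left_mono)
    have "exp (c * f x) \<le> 1 + c * f x + (c * f x)\<^sup>2 / (2 * (1 - \<bar>c * f x\<bar> / 3))"
      using le c by (intro exp_le_quadratic) auto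
    also have "\<dots> \<le> 1 + c * f x + (c * f x)\<^sup>2 / (2 * (1 - c * b / 3))"
      using le c by (intro add_left_mono divide_left_mono mult_pos_pos) simp_all
    finally show "exp (c * f x) \<le> 1 + c * f x + K * (f x)\<^sup>2"
      by (simp add: K_def power_mult_distrib)
  qed
  have "(\<integral>\<^sup>+x. exp (c * f x) \<partial>M) \<le> (\<integral>\<^sup>+x. ennreal (1 + c * f x + K * (f x)\<^sup>2) \<partial>M)"
    using quad by (intro nn_integral_mono_AE) (auto intro: ennreal_leI)
  also have "\<dots> = ennreal (expectation (\<lambda>x. 1 + c * f x + K * (f x)\<^sup>2))"
  proof (rule nn_integral_eq_integral)
    show "AE x in M. 0 \<le> 1 + c * f x + K * (f x)\<^sup>2"
      using quad by eventually_elim (meson exp_ge_zero order_trans)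
  qed (use int int2 in auto)
  also have "expectation (\<lambda>x. 1 + c * f x + K * (f x)\<^sup>2) = 1 + K * expectation (\<lambda>x. (f x)\<^sup>2)"
    using int int2 E0 by (simp add: prob_space)
  also have "ennreal \<dots> \<le> ennreal (exp (K * expectation (\<lambda>x. (f x)\<^sup>2)))"
    by (intro ennreal_leI exp_ge_add_one_self)
  finally show ?thesis
    by (simp add: K_def)
qed

theorem (in prob_space) Bernstein_ineq_ge:
  fixes Y :: "'i \<Rightarrow> 'a \<Rightarrow> real"
  assumes fin: "finite I" and indep: "indep_vars (\<lambda>_. borel) Y I"
    and bnd: "\<And>i. i \<in> I \<Longrightarrow> AE x in M. \<bar>Y i x - expectation (Y i)\<bar> \<le> b" and b: "0 \<le> b"
    and var: "(\<Sum>i\<in>I. variance (Y i)) \<le> v" and v: "0 < v" and s: "0 < s"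
  shows "prob {x\<in>space M. (\<Sum>i\<in>I. Y i x) \<ge> (\<Sum>i\<in>I. expectation (Y i)) + s}
           \<le> exp (- s\<^sup>2 / (2 * (v + b * s / 3)))"
proof -
  define Z where "Z = (\<lambda>i x. Y i x - expectation (Y i))"
  have rv [measurable]: "random_variable borel (Y i)" if "i \<in> I" for i
    using that indep unfolding indep_vars_def by blast
  have rvZ [measurable]: "random_variable borel (Z i)" if "i \<in> I" for i
    using that unfolding Z_def by measurable
  have EZ: "expectation (Z i) = 0" if i: "i \<in> I" for i
  proof -
    have "integrable M (Z i)"
      by (rule integrable_const_bound[where B = b]) (use bnd[OF i] i in \<open>auto simp: Z_def\<close>)
    then have "integrable M (\<lambda>x. Z i x + expectation (Y i))"
      by simp
    then show ?thesis
      by (simp add: Z_def prob_space)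
  qed
  \<comment> \<open>The value of \<open>c\<close> is chosen so that \<open>1 - c * b / 3\<close> is \<open>v / (v + b * s / 3)\<close>; the quadratic
      term of the Chernoff exponent is then half the linear one.\<close>
  define D where "D = v + b * s / 3"
  define c where "c = s / D"
  have D: "D > 0"
    using v b s by (simp add: D_def add_pos_nonneg)
  have c: "c > 0"
    using s D by (simp add: c_def)
  have rest: "1 - c * b / 3 = v / D"
    using D by (simp add: c_def eq_divide_eq left_diff_distrib) (simp add: D_def)
  have cb: "c * b < 3"
  proof -
    have "v / D > 0"
      using v D by simp
    then show ?thesis
      using rest by linarith
  qed
  define K where "K = c\<^sup>2 / (2 * (1 - c * b / 3))"
  have K: "K \<ge> 0"
    unfolding K_def using cb by (intro divide_nonneg_nonneg mult_nonneg_nonneg) simp_all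
  have "{x\<in>space M. (\<Sum>i\<in>I. Y i x) \<ge> (\<Sum>i\<in>I. expectation (Y i)) + s}
          = {x\<in>space M. (\<Sum>i\<in>I. Z i x) \<ge> s}"
    by (auto simp: Z_def sum_subtractf)
  then have "ennreal (prob {x\<in>space M. (\<Sum>i\<in>I. Y i x) \<ge> (\<Sum>i\<in>I. expectation (Y i)) + s})
               = emeasure M {x\<in>space M. (\<Sum>i\<in>I. Z i x) \<ge> s}"
    by (simp add: emeasure_eq_measure)
  also have "\<dots> \<le> ennreal (exp (- c * s)) * (\<integral>\<^sup>+x\<in>space M. exp (c * (\<Sum>i\<in>I. Z i x)) \<partial>M)"
    using c by (intro Chernoff_ineq_nn_integral_ge) auto
  also have "(\<integral>\<^sup>+x\<in>space M. exp (c * (\<Sum>i\<in>I. Z i x)) \<partial>M)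
               = (\<integral>\<^sup>+x. (\<Prod>i\<in>I. ennreal (exp (c * Z i x))) \<partial>M)"
    by (intro nn_integral_cong) (simp_all add: sum_distrib_left exp_sum fin prod_ennreal)
  also have "\<dots> = (\<Prod>i\<in>I. \<integral>\<^sup>+x. ennreal (exp (c * Z i x)) \<partial>M)"
    unfolding Z_def by (intro indep_vars_nn_integral fin indep_vars_compose2[OF indep]) auto
  also have "ennreal (exp (- c * s)) * \<dots>
               \<le> ennreal (exp (- c * s)) * (\<Prod>i\<in>I. ennreal (exp (K * variance (Y i))))"
  proof (intro mult_left_mono prod_mono_ennreal)
    fix i assume i: "i \<in> I"
    have "(\<integral>\<^sup>+x. ennreal (exp (c * Z i x)) \<partial>M)
            \<le> ennreal (exp (c\<^sup>2 * expectation (\<lambda>x. (Z i x)\<^sup>2) / (2 * (1 - c * b / 3))))"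
      using bnd[OF i] EZ[OF i] c cb i by (intro Bernstein_lemma_nn_integral) (auto simp: Z_def)
    then show "(\<integral>\<^sup>+x. ennreal (exp (c * Z i x)) \<partial>M) \<le> ennreal (exp (K * variance (Y i)))"
      by (simp add: K_def Z_def)
  qed auto
  also have "\<dots> = ennreal (exp (- c * s) * (\<Prod>i\<in>I. exp (K * variance (Y i))))"
    by (simp add: prod_ennreal prod_nonneg flip: ennreal_mult)
  also have "exp (- c * s) * (\<Prod>i\<in>I. exp (K * variance (Y i)))
               = exp (- c * s + K * (\<Sum>i\<in>I. variance (Y i)))"
    by (simp only: exp_add exp_sum[OF fin] sum_distrib_left)
  also have "ennreal \<dots> \<le> ennreal (exp (- c * s + K * v))"
    using K var by (intro ennreal_leI) (simp add: mult_left_mono)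
  also have "- c * s + K * v = - s\<^sup>2 / (2 * (v + b * s / 3))"
  proof -
    have "K * v = c\<^sup>2 * D / 2"
      using v D by (simp add: K_def rest)
    then show ?thesis
      using D by (simp add: c_def D_def[symmetric] power2_eq_square)
  qed
  finally show ?thesis
    by (subst (asm) ennreal_le_iff) simp_all
qed

section \<open>Error probability of the test\<close>

lemma bounded_of_oscillation_le:
  fixes f :: "'a \<Rightarrow> real"
  assumes osc: "(SUP x\<in>A. ereal (f x)) - (INF x\<in>A. ereal (f x)) \<le> ereal d" and ne: "A \<noteq> {}"
  obtains m where "\<And>x. x \<in> A \<Longrightarrow> f x \<in> {m..m + d}"
proof -
  define S I where "S = (SUP x\<in>A. ereal (f x))" and "I = (INF x\<in>A. ereal (f x))"
  have up: "ereal (f x) \<le> S" and low: "I \<le> ereal (f x)" if "x \<in> A" for x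
    using that by (auto simp: S_def I_def intro: SUP_upper INF_lower)
  obtain y where "y \<in> A"
    using ne by blast
  then have "\<exists>i. I = ereal i"
    using osc up[of y] low[of y] unfolding S_def[symmetric] I_def[symmetric]
    by (cases I; cases S) auto
  then obtain m where m: "I = ereal m" ..
  show thesis
  proof (rule that[of m])
    fix x assume "x \<in> A"
    then show "f x \<in> {m..m + d}"
      using osc up[of x] low[of x] m unfolding S_def[symmetric] I_def[symmetric]
      by (cases S) auto
  qed
qed

theorem proposition14:
  fixes \<mu> :: "'a measure" and n :: nat
    and \<PP> :: "'a measure set"
    and \<MM> :: "'a signed_measure set"
    and \<MM>n :: "(nat \<Rightarrow> 'a signed_measure) set"
    and l :: "'a measure \<Rightarrow> 'a signed_measure \<Rightarrow> real"
    and t :: "'a signed_measure \<times> 'a signed_measure \<Rightarrow> 'a \<Rightarrow> real"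
    and a0 a1 \<gamma> :: real
    and \<Omega> :: "'w measure" and X :: "nat \<Rightarrow> 'w \<Rightarrow> 'a"
    and Pstar :: "nat \<Rightarrow> 'a measure"
    and P Q :: "nat \<Rightarrow> 'a signed_measure"
    and \<Phi> :: "(nat \<Rightarrow> 'a) \<Rightarrow> nat"
  assumes sigma_finite: "sigma_finite_measure \<mu>" and n: "n \<ge> 1"
    and PP: "\<And>S. S \<in> \<PP> \<Longrightarrow> prob_space S \<and> sets S = sets \<mu>"
    and MM: "countable \<MM>" "\<And>R. R \<in> \<MM> \<Longrightarrow> finite_signed_ac \<mu> R"
    and MMn: "\<MM>n \<subseteq> {1..n} \<rightarrow>\<^sub>E \<MM>"
    and loss: "\<And>S R. S \<in> \<PP> \<Longrightarrow> R \<in> \<MM> \<Longrightarrow> 0 \<le> l S R"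
      "\<exists>S\<in>\<PP>. \<exists>R\<in>\<MM>. l S R \<noteq> 0"
    and adm: "admissible_family \<mu> \<PP> \<MM> l a0 a1 t" and a: "a0 \<ge> a1" "a1 > 0"
    and PQ: "P \<in> \<MM>n" "Q \<in> \<MM>n" "P \<noteq> Q"
    and Pstar: "Pstar \<in> {1..n} \<rightarrow>\<^sub>E \<PP>"
    and prob: "prob_space \<Omega>"
    and indep: "prob_space.indep_vars \<Omega> (\<lambda>_. \<mu>) X {1..n}"
    and law: "\<And>i. i \<in> {1..n} \<Longrightarrow> distr \<Omega> \<mu> (X i) = Pstar i"
    and test: "is_test \<mu> t n P Q \<Phi>"
    and pos: "total_loss l n Pstar Q > 0"
    and gamma: "\<gamma> = (a0 * total_loss l n Pstar P) / (a1 * total_loss l n Pstar Q)" "\<gamma> < 1"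
  shows "\<P>(\<omega> in \<Omega>. \<Phi> (\<lambda>i\<in>{1..n}. X i \<omega>) = 1)
           \<le> exp (- (2 * (total_loss l n Pstar Q)\<^sup>2 / real n) * (a1 * (1 - \<gamma>))\<^sup>2) \<and>
         (\<forall>a2>0.
           (\<forall>S\<in>\<PP>. \<forall>R\<in>\<MM>. \<forall>R'\<in>\<MM>.
              prob_space.variance S (t (R, R')) \<le> a2 * (l S R + l S R')) \<longrightarrow>
           \<P>(\<omega> in \<Omega>. \<Phi> (\<lambda>i\<in>{1..n}. X i \<omega>) = 1)
             \<le> exp (- (total_loss l n Pstar Q / 2) *
                    (a1 * (1 - \<gamma>)\<^sup>2 / ((1 - \<gamma>) / 3 + (1 + \<gamma> * (a1 / a0)) * (a2 / a1)))))"
proof -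
  interpret prob_space \<Omega> by fact
  define LP LQ where "LP = total_loss l n Pstar P" and "LQ = total_loss l n Pstar Q"
  define T where "T = (\<lambda>i. t (P i, Q i))"
  define Y where "Y = (\<lambda>i \<omega>. T i (X i \<omega>))"
  define s where "s = a1 * (1 - \<gamma>) * LQ"
  have in_MM: "P i \<in> \<MM>" "Q i \<in> \<MM>" if "i \<in> {1..n}" for i
    using PQ MMn that by (meson PiE_mem subsetD)+
  have t_meas: "t (R, R') \<in> borel_measurable \<mu>"
    and t_osc: "(SUP x\<in>space \<mu>. ereal (t (R, R') x)) - (INF x\<in>space \<mu>. ereal (t (R, R') x)) \<le> 1"
    if "R \<in> \<MM>" "R' \<in> \<MM>" for R R'
    using adm that unfolding admissible_family_def by blast+
  have t_mean: "prob_space.expectation S (t (R, R')) \<le> a0 * l S R - a1 * l S R'"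
    if "S \<in> \<PP>" "R \<in> \<MM>" "R' \<in> \<MM>" for S R R'
    using adm that unfolding admissible_family_def by blast
  have in_PP: "Pstar i \<in> \<PP>" if "i \<in> {1..n}" for i
    using Pstar that by auto
  have LQ: "LQ > 0"
    using pos by (simp add: LQ_def)
  have a0: "a0 > 0"
    using a by simp
  have LP: "LP = \<gamma> * (a1 / a0) * LQ"
    using gamma(1) LQ a a0 by (simp add: LP_def[symmetric] LQ_def[symmetric] field_simps)
  have LP_nonneg: "LP \<ge> 0"
    unfolding LP_def total_loss_def using loss(1) in_MM in_PP by (intro sum_nonneg) auto
  have s: "s > 0"
    using LQ a gamma(2) by (simp add: s_def)
  have rv_X: "random_variable \<mu> (X i)" if "i \<in> {1..n}" for i
    using indep that unfolding indep_vars_def by blast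
  have T_meas [measurable]: "T i \<in> borel_measurable \<mu>" if "i \<in> {1..n}" for i
    unfolding T_def using in_MM[OF that] by (rule t_meas)
  have indep_Y: "indep_vars (\<lambda>_. borel) Y {1..n}"
    unfolding Y_def by (rule indep_vars_compose2[OF indep T_meas])
  have Y_meas [measurable]: "random_variable borel (Y i)" if "i \<in> {1..n}" for i
    unfolding Y_def using measurable_compose[OF rv_X T_meas] that by blast
  have transfer: "expectation (\<lambda>\<omega>. g (X i \<omega>)) = prob_space.expectation (Pstar i) g"
    if "i \<in> {1..n}" "g \<in> borel_measurable \<mu>" for i and g :: "'a \<Rightarrow> real"
    using integral_distr[OF rv_X that(2), of i] law[of i] that by simp
  have EY: "expectation (Y i) = prob_space.expectation (Pstar i) (T i)" if "i \<in> {1..n}" for i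
    unfolding Y_def by (rule transfer[OF that T_meas[OF that]])
  have VY: "variance (Y i) = prob_space.variance (Pstar i) (T i)" if "i \<in> {1..n}" for i
    unfolding EY[OF that] unfolding Y_def using T_meas[OF that] that by (intro transfer) auto

  have "\<exists>m. \<forall>i\<in>{1..n}. \<forall>x\<in>space \<mu>. T i x \<in> {m i..m i + 1}"
  proof (intro bchoice ballI)
    fix i assume i: "i \<in> {1..n}"
    have "space \<mu> \<noteq> {}"
      using rv_X[OF i] not_empty by (auto dest: measurable_space)
    moreover have "(SUP x\<in>space \<mu>. ereal (T i x)) - (INF x\<in>space \<mu>. ereal (T i x)) \<le> ereal 1"
      using t_osc[OF in_MM[OF i]] by (simp add: T_def one_ereal_def)
    ultimately obtain m where "\<And>x. x \<in> space \<mu> \<Longrightarrow> T i x \<in> {m..m + 1}"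
      using bounded_of_oscillation_le by metis
    then show "\<exists>m. \<forall>x\<in>space \<mu>. T i x \<in> {m..m + 1}"
      by blast
  qed
  then obtain m where m: "\<And>i x. i \<in> {1..n} \<Longrightarrow> x \<in> space \<mu> \<Longrightarrow> T i x \<in> {m i..m i + 1}"
    by blast
  have Y_bounds: "AE \<omega> in \<Omega>. Y i \<omega> \<in> {m i..m i + 1}" if "i \<in> {1..n}" for i
    using m[OF that measurable_space[OF rv_X[OF that]]] by (auto simp: Y_def)

  have mean: "(\<Sum>i=1..n. expectation (Y i)) + s \<le> 0"
  proof -
    have "(\<Sum>i=1..n. expectation (Y i)) \<le> (\<Sum>i=1..n. a0 * l (Pstar i) (P i) - a1 * l (Pstar i) (Q i))"
      using t_mean in_MM in_PP by (intro sum_mono) (simp add: EY T_def)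
    also have "\<dots> = a0 * LP - a1 * LQ"
      by (simp add: LP_def LQ_def total_loss_def sum_subtractf sum_distrib_left)
    also have "\<dots> = - s"
      using a0 by (simp add: LP s_def algebra_simps)
    finally show ?thesis
      by simp
  qed

  have error_le: "\<P>(\<omega> in \<Omega>. \<Phi> (\<lambda>i\<in>{1..n}. X i \<omega>) = 1)
      \<le> prob {\<omega>\<in>space \<Omega>. (\<Sum>i=1..n. Y i \<omega>) \<ge> (\<Sum>i=1..n. expectation (Y i)) + s}"
  proof (rule finite_measure_mono)
    show "{\<omega>\<in>space \<Omega>. \<Phi> (\<lambda>i\<in>{1..n}. X i \<omega>) = 1}
        \<subseteq> {\<omega>\<in>space \<Omega>. (\<Sum>i=1..n. Y i \<omega>) \<ge> (\<Sum>i=1..n. expectation (Y i)) + s}"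
    proof safe
      fix \<omega> assume \<omega>: "\<omega> \<in> space \<Omega>" and one: "\<Phi> (\<lambda>i\<in>{1..n}. X i \<omega>) = 1"
      have "(\<lambda>i\<in>{1..n}. X i \<omega>) \<in> space (PiM {1..n} (\<lambda>_. \<mu>))"
        using measurable_space[OF rv_X \<omega>] by (auto simp: space_PiM)
      then have "\<not> test_statistic t n (\<lambda>i\<in>{1..n}. X i \<omega>) P Q < 0"
        using test one unfolding is_test_def by fastforce
      moreover have "test_statistic t n (\<lambda>i\<in>{1..n}. X i \<omega>) P Q = (\<Sum>i=1..n. Y i \<omega>)"
        unfolding test_statistic_def Y_def T_def by (intro sum.cong) auto
      ultimately show "(\<Sum>i=1..n. expectation (Y i)) + s \<le> (\<Sum>i=1..n. Y i \<omega>)"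
        using mean by simp
    qed
  qed measurable

  have first: "\<P>(\<omega> in \<Omega>. \<Phi> (\<lambda>i\<in>{1..n}. X i \<omega>) = 1)
      \<le> exp (- (2 * LQ\<^sup>2 / real n) * (a1 * (1 - \<gamma>))\<^sup>2)"
  proof -
    interpret Hoeffding_ineq \<Omega> "{1..n}" Y m "\<lambda>i. m i + 1" "\<Sum>i=1..n. expectation (Y i)"
      by unfold_locales (use indep_Y Y_bounds in auto)
    note error_le
    also have "prob {\<omega>\<in>space \<Omega>. (\<Sum>i=1..n. Y i \<omega>) \<ge> (\<Sum>i=1..n. expectation (Y i)) + s}
        \<le> exp (- 2 * s\<^sup>2 / (\<Sum>i=1..n. (m i + 1 - m i)\<^sup>2))"
      using s n by (intro Hoeffding_ineq_ge) auto
    also have "- 2 * s\<^sup>2 / (\<Sum>i=1..n. (m i + 1 - m i)\<^sup>2)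
        = - (2 * LQ\<^sup>2 / real n) * (a1 * (1 - \<gamma>))\<^sup>2"
      by (simp add: s_def power_mult_distrib)
    finally show ?thesis .
  qed

  have second: "\<P>(\<omega> in \<Omega>. \<Phi> (\<lambda>i\<in>{1..n}. X i \<omega>) = 1)
      \<le> exp (- (LQ / 2) * (a1 * (1 - \<gamma>)\<^sup>2 / ((1 - \<gamma>) / 3 + (1 + \<gamma> * (a1 / a0)) * (a2 / a1))))"
    if a2: "a2 > 0"
      and var: "\<forall>S\<in>\<PP>. \<forall>R\<in>\<MM>. \<forall>R'\<in>\<MM>. prob_space.variance S (t (R, R')) \<le> a2 * (l S R + l S R')"
    for a2
  proof -
    define v where "v = a2 * (LP + LQ)"
    have v: "v > 0"
      using a2 LQ LP_nonneg by (simp add: v_def)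
    have near_mean: "AE \<omega> in \<Omega>. \<bar>Y i \<omega> - expectation (Y i)\<bar> \<le> 1" if i: "i \<in> {1..n}" for i
    proof -
      interpret Yi: interval_bounded_random_variable \<Omega> "Y i" "m i" "m i + 1"
        by unfold_locales (use Y_bounds[OF i] Y_meas[OF i] in auto)
      have "m i \<le> expectation (Y i)" "expectation (Y i) \<le> m i + 1"
        using Y_bounds[OF i] by (auto intro!: integral_ge_const integral_le_const Yi.integrable)
      then show ?thesis
        using Y_bounds[OF i] by (auto simp: abs_le_iff)
    qed
    have "(\<Sum>i=1..n. variance (Y i)) \<le> (\<Sum>i=1..n. a2 * (l (Pstar i) (P i) + l (Pstar i) (Q i)))"
      using var in_MM in_PP by (intro sum_mono) (simp add: VY T_def)
    also have "\<dots> = v"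
      by (simp add: v_def LP_def LQ_def total_loss_def sum.distrib sum_distrib_left distrib_left)
    finally have var_sum: "(\<Sum>i=1..n. variance (Y i)) \<le> v" .
    note error_le
    also have "prob {\<omega>\<in>space \<Omega>. (\<Sum>i=1..n. Y i \<omega>) \<ge> (\<Sum>i=1..n. expectation (Y i)) + s}
        \<le> exp (- s\<^sup>2 / (2 * (v + 1 * s / 3)))"
      using indep_Y near_mean var_sum v s by (intro Bernstein_ineq_ge) auto
    also have "- s\<^sup>2 / (2 * (v + 1 * s / 3))
        = - (LQ / 2) * (a1 * (1 - \<gamma>)\<^sup>2 / ((1 - \<gamma>) / 3 + (1 + \<gamma> * (a1 / a0)) * (a2 / a1)))"
    proof -
      define d where "d = (1 - \<gamma>) / 3 + (1 + \<gamma> * (a1 / a0)) * (a2 / a1)"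
      have "v + 1 * s / 3 = a1 * LQ * d"
        using a by (simp add: v_def s_def d_def LP field_simps)
      moreover have "s\<^sup>2 = a1 * LQ * (LQ * (a1 * (1 - \<gamma>)\<^sup>2))"
        by (simp add: s_def power2_eq_square)
      ultimately show ?thesis
        using a LQ unfolding d_def[symmetric] by simp
    qed
    finally show ?thesis .
  qed

  show ?thesis
    using first second unfolding LQ_def by blast
qed

end
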